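(* Let $r\ge 2$ and $m\ge 2$ be integers, and let $P_{-2r,k}(c)$ and $P_{-r,k}(c)$ ($k\ge -2r$) be the type 1 and type 2 polynomial families defined in the context. (i) For every integer $n\ge 0$, the polynomial $P_n(c):=P_{-2r,n-2r}(c)$ (the coefficient of $z^n$ in the type 1 generating function) satisfies the fourth-order linear ordinary differential equation $$(c^2-1)^2m^2r^4P_n^{(\mathrm{iv})}+10c(c^2-1)m^2r^4P_n'''+\bigl[X^{(1)}_nc^2+Y^{(1)}_n\bigr]P_n''+Z^{(1)}_n\,c\,P_n'+W^{(1)}_nP_n=0,$$ where $$W^{(1)}_n=n(n-2r)\bigl(m(n-2r+2)+2r\bigr)\bigl(m(n-4r+2)+2r\bigr),$$ $$X^{(1)}_n=r^2\bigl(-2m^2((n+2)n+2)+4mr(m(2n+3)-n-2)+r^2(3m(5m+4)-4)\bigr),$$ $$Y^{(1)}_n=r^2\bigl(2m^2((n+2)n+2)-4mr(m(2n+3)-n-2)-16mr^2\bigr),$$ $$Z^{(1)}_n=-3r^2\bigl(m^2(-8nr+2(n+2)n+5r^2-12r+4)+4mr(n-3r+2)+4r^2\bigr).$$ (ii) For every integer $n\ge 0$, the polynomial $P_n(c):=P_{-r,n-2r}(c)$ (the coefficient of $z^n$ in the type 2 generating function) satisfies the fourth-order linear ordinary differential equation $$(c^2-1)^2m^2r^4P_n^{(\mathrm{iv})}+10c(c^2-1)m^2r^4P_n'''+\bigl[X^{(2)}_nc^2+Y^{(2)}_n\bigr]P_n''+Z^{(2)}_n\,c\,P_n'+W^{(2)}_nP_n=0,$$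 where, setting $\Delta=r^2(r-2)m(2mn-7mr+2m+4r)$, $$W^{(2)}_n=(n^2-r^2)\bigl(m(n-5r+2)+2r\bigr)\bigl(m(n-3r+2)+2r\bigr),$$ $$X^{(2)}_n=-2r^2\bigl(m^2((n-r)(n-2r)-10r^2)+2mr(n-3r)+2r^2\bigr)+\Delta,$$ $$Y^{(2)}_n=2r^2\bigl(m^2((n-r)(n-2r)-(2r^2+r))+2mr(n-4r)\bigr)-r^2(r-2)m\bigl(2mn-6mr+2m+4r\bigr),$$ $$Z^{(2)}_n=-3r^2\bigl(2m^2(n-r)(n-2r)+4mr(n-3r)+4r^2\bigr)+3\Delta.$$ Here primes and $(\mathrm{iv})$ denote derivatives with respect to $c$.
   Context: For integers $r,m\ge 2$ consider sequences of polynomials $(P_k(c))_{k\ge -2r}$ in $\mathbb{C}[c]$ satisfying, for all integers $k\ge 0$, the recursion $$(2r+m+km)P_k(c)=2c\,(r+(1+k-r)m)\,P_{k-r}(c)-(k-(2r-1))\,m\,P_{k-2r}(c).$$ Such a sequence is uniquely determined by its initial values $P_{-2r},\dots,P_{-1}$. Type 1 family: $P_{-2r,k}(c)$, $k\ge -2r$, is the solution with $P_{-2r}=1$ and $P_j=0$ for $j\in\{-2r+1,\dots,-1\}$; its generating function is $\sum_{k\ge 0}P_{-2r,k-2r}(c)\,z^k$. Type 2 family: $P_{-r,k}(c)$, $k\ge -2r$, is the solution with $P_{-r}=1$ and $P_j=0$ for $j\in\{-2r,\dots,-1\}$, $j\ne -r$; its generating function is $\sum_{k\ge 0}P_{-r,k-2r}(c)\,z^k$.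 *)

theory Defs
  imports Complex_Main "HOL-Computational_Algebra.Polynomial"
begin

text \<open>
  Elements of \<open>\<complex>[c]\<close> are values of type \<^typ>\<open>complex poly\<close>; the indeterminate is
  \<open>cvar\<close>, and integer scalars enter through \<^const>\<open>of_int\<close>.
  A sequence \<open>(P\<^sub>k)\<close> with \<open>k \<ge> -2r\<close> is an integer-indexed function of
  which only the values at \<open>k \<ge> -2r\<close> are ever constrained or used.
\<close>

abbreviation cvar :: "complex poly" where
  "cvar \<equiv> [:0, 1:]"

definition satisfies_recursion :: "int \<Rightarrow> int \<Rightarrow> (int \<Rightarrow> complex poly) \<Rightarrow> bool" where
  "satisfies_recursion r m P \<longleftrightarrow>
     (\<forall>k\<ge>0. of_int (2*r + m + k*m) * P k =
        2 * cvar * of_int (r + (1 + k - r)*m) * P (k - r)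
        - of_int ((k - (2*r - 1)) * m) * P (k - 2*r))"

definition type1_family :: "int \<Rightarrow> int \<Rightarrow> (int \<Rightarrow> complex poly) \<Rightarrow> bool" where
  "type1_family r m P \<longleftrightarrow> satisfies_recursion r m P \<and>
     P (-2*r) = 1 \<and> (\<forall>j\<in>{-2*r+1..-1}. P j = 0)"

definition type2_family :: "int \<Rightarrow> int \<Rightarrow> (int \<Rightarrow> complex poly) \<Rightarrow> bool" where
  "type2_family r m P \<longleftrightarrow> satisfies_recursion r m P \<and>
     P (-r) = 1 \<and> (\<forall>j\<in>{-2*r..-1}. j \<noteq> -r \<longrightarrow> P j = 0)"

definition W1 :: "int \<Rightarrow> int \<Rightarrow> int \<Rightarrow> int" where
  "W1 r m n = n * (n - 2*r) * (m*(n - 2*r + 2) + 2*r) * (m*(n - 4*r + 2) + 2*r)"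

definition X1 :: "int \<Rightarrow> int \<Rightarrow> int \<Rightarrow> int" where
  "X1 r m n = r^2 * (-2*m^2*((n + 2)*n + 2) + 4*m*r*(m*(2*n + 3) - n - 2)
                     + r^2*(3*m*(5*m + 4) - 4))"

definition Y1 :: "int \<Rightarrow> int \<Rightarrow> int \<Rightarrow> int" where
  "Y1 r m n = r^2 * (2*m^2*((n + 2)*n + 2) - 4*m*r*(m*(2*n + 3) - n - 2) - 16*m*r^2)"

definition Z1 :: "int \<Rightarrow> int \<Rightarrow> int \<Rightarrow> int" where
  "Z1 r m n = -3*r^2 * (m^2*(-8*n*r + 2*(n + 2)*n + 5*r^2 - 12*r + 4)
                        + 4*m*r*(n - 3*r + 2) + 4*r^2)"

definition Delta2 :: "int \<Rightarrow> int \<Rightarrow> int \<Rightarrow> int" where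
  "Delta2 r m n = r^2 * (r - 2) * m * (2*m*n - 7*m*r + 2*m + 4*r)"

definition W2 :: "int \<Rightarrow> int \<Rightarrow> int \<Rightarrow> int" where
  "W2 r m n = (n^2 - r^2) * (m*(n - 5*r + 2) + 2*r) * (m*(n - 3*r + 2) + 2*r)"

definition X2 :: "int \<Rightarrow> int \<Rightarrow> int \<Rightarrow> int" where
  "X2 r m n = -2*r^2 * (m^2*((n - r)*(n - 2*r) - 10*r^2) + 2*m*r*(n - 3*r) + 2*r^2)
              + Delta2 r m n"

definition Y2 :: "int \<Rightarrow> int \<Rightarrow> int \<Rightarrow> int" where
  "Y2 r m n = 2*r^2 * (m^2*((n - r)*(n - 2*r) - (2*r^2 + r)) + 2*m*r*(n - 4*r))
              - r^2 * (r - 2) * m * (2*m*n - 6*m*r + 2*m + 4*r)"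

definition Z2 :: "int \<Rightarrow> int \<Rightarrow> int \<Rightarrow> int" where
  "Z2 r m n = -3*r^2 * (2*m^2*(n - r)*(n - 2*r) + 4*m*r*(n - 3*r) + 4*r^2)
              + 3 * Delta2 r m n"

definition satisfies_ode ::
  "int \<Rightarrow> int \<Rightarrow> int \<Rightarrow> int \<Rightarrow> int \<Rightarrow> int \<Rightarrow> complex poly \<Rightarrow> bool" where
  "satisfies_ode r m X Y Z W p \<longleftrightarrow>
     (cvar^2 - 1)^2 * of_int (m^2 * r^4) * (pderiv ^^ 4) p
     + 10 * cvar * (cvar^2 - 1) * of_int (m^2 * r^4) * (pderiv ^^ 3) p
     + (of_int X * cvar^2 + of_int Y) * (pderiv ^^ 2) p
     + of_int Z * cvar * pderiv p
     + of_int W * p = 0"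

text \<open>
  The recursion has exactly one solution for any initial values, so quantifying over
  all \<open>P\<close> with \<open>type1_family r m P\<close> (or \<open>type2_family r m P\<close>) refers to one sequence.
\<close>

function recursion_solution ::
  "int \<Rightarrow> int \<Rightarrow> (int \<Rightarrow> complex poly) \<Rightarrow> int \<Rightarrow> complex poly" where
  "recursion_solution r m f k =
     (if k < 0 \<or> r \<le> 0 then f k
      else smult (1 / of_int (2*r + m + k*m))
        (2 * cvar * of_int (r + (1 + k - r)*m) * recursion_solution r m f (k - r)
         - of_int ((k - (2*r - 1)) * m) * recursion_solution r m f (k - 2*r)))"
  by pat_completeness auto
termination
  by (relation "measure (\<lambda>(r, m, f, k). nat (k + 1))") auto

declare recursion_solution.simps [simp del]

lemma recursion_exists:
  assumes "r \<ge> 2" "m \<ge> 2"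
  shows "\<exists>P. satisfies_recursion r m P \<and> (\<forall>j\<in>{-2*r..-1}. P j = f j)"
proof (intro exI conjI ballI)
  show "satisfies_recursion r m (recursion_solution r m f)"
    unfolding satisfies_recursion_def
  proof (intro allI impI)
    fix k :: int assume k: "k \<ge> 0"
    have "2*r + m + k*m > 0" using assms k by (simp add: add_pos_nonneg)
    then have nz: "(of_int (2*r + m + k*m) :: complex) \<noteq> 0" by (metis of_int_eq_0_iff less_irrefl)
    have "of_int z * smult (1 / of_int z) q = q" if "(of_int z :: complex) \<noteq> 0" for z and q :: "complex poly"
      using that by (simp add: of_int_poly)
    note cancel = this[OF nz]
    have "\<not> (k < 0 \<or> r \<le> 0)" using k assms by simp
    note eq = recursion_solution.simps[of r m f k, unfolded if_not_P[OF this]]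
    show "of_int (2*r + m + k*m) * recursion_solution r m f k =
        2 * cvar * of_int (r + (1 + k - r)*m) * recursion_solution r m f (k - r)
        - of_int ((k - (2*r - 1)) * m) * recursion_solution r m f (k - 2*r)"
      unfolding eq by (rule cancel)
  qed
  show "recursion_solution r m f j = f j" if "j \<in> {-2*r..-1}" for j
    using that by (subst recursion_solution.simps) simp
qed

lemma recursion_unique:
  assumes "r \<ge> 2" "m \<ge> 2"
    and "satisfies_recursion r m P" "satisfies_recursion r m Q"
    and "\<And>j. j \<in> {-2*r..-1} \<Longrightarrow> P j = Q j"
    and "k \<ge> -2*r"
  shows "P k = Q k"
  using assms(6)
proof (induction "nat (k + 2*r)" arbitrary: k rule: less_induct)
  case less
  show ?case
  proof (cases "k < 0")
    case True
    then show ?thesis using less.prems assms(5) by simp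
  next
    case False
    have "2*r + m + k*m > 0" using assms False by (simp add: add_pos_nonneg)
    then have nz: "(of_int (2*r + m + k*m) :: complex poly) \<noteq> 0"
      by (metis of_int_eq_0_iff less_irrefl)
    have "P (k - r) = Q (k - r)" "P (k - 2*r) = Q (k - 2*r)"
      using less.hyps[of "k - r"] less.hyps[of "k - 2*r"] False assms(1) by auto
    then have "of_int (2*r + m + k*m) * P k = of_int (2*r + m + k*m) * Q k"
      using assms(3,4) False unfolding satisfies_recursion_def by (metis not_less)
    with nz show ?thesis by (metis mult_left_cancel)
  qed
qed

end

theory Submission
  imports Defs
begin

text \<open>
  A polynomial of either family vanishes unless its index is a multiple of \<open>r\<close>.  Along these indices,
  \<open>n = r j\<close>, the recursion is that of the ultraspherical polynomials with parameter
  \<open>\<lambda> = -1/m\<close>, except that the degree runs through \<open>j + s\<close> for a constant shift \<open>s\<close>: the two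
  families are \<^emph>\<open>associated\<close> ultraspherical polynomials.

  For the classical functions \<open>C\<^sub>\<nu>\<close> the passage from \<open>(C\<^sub>\<nu>\<^sub>-\<^sub>1, C\<^sub>\<nu>\<^sub>-\<^sub>2)\<close> to \<open>(C\<^sub>\<nu>, C\<^sub>\<nu>\<^sub>-\<^sub>1)\<close> is a
  \<open>2 \<times> 2\<close> transfer matrix, compatible with a first-order system
  \<open>(c\<^sup>2 - 1) Y\<^sub>j' = A\<^sub>j Y\<^sub>j\<close>, where the matrix \<open>A\<^sub>j\<close> is linear in \<open>c\<close>.  The type 2 and type 1
  polynomials \<open>f\<^sub>j\<close> and \<open>g\<^sub>j\<close> form the upper row, and \<open>f\<^sub>j\<^sub>-\<^sub>1\<close> and \<open>g\<^sub>j\<^sub>-\<^sub>1\<close> the lower row, of the product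
  \<open>M\<^sub>j = Y\<^sub>j Y\<^sub>1\<^sup>-\<^sup>1\<close> of transfer matrices, and therefore
  \<open>(c\<^sup>2 - 1) M\<^sub>j' = A\<^sub>j M\<^sub>j - M\<^sub>j A\<^sub>1\<close>.
  Lemma \<open>ladder_relations\<close> proves this closed system of differential-difference relations by
  induction from the recursion alone, so that no special functions are needed.

  The relation also says that each entry \<open>y\<close> of \<open>M\<^sub>j\<close> behaves like a product of two functions, one
  for \<open>A\<^sub>j\<close> acting from the left and one for \<open>A\<^sub>1\<close> acting from the right, and each of the two
  satisfies a second-order equation.  A product of solutions of two second-order equations
  satisfies a fourth-order one; lemma \<open>product_ode\<close> carries out this elimination.  The integer
  coefficients that come out are, up to the factor \<open>m\<^sup>2\<close>, those of the claim.
\<close>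

section \<open>The equation of a product of two solutions\<close>

text \<open>
  The hypotheses describe \<open>y = u v\<close>, with \<open>\<delta> = K p d/dx\<close>, \<open>U = (\<delta> u) v\<close>, \<open>V = u (\<delta> v)\<close> and
  \<open>T = (\<delta> u) (\<delta> v)\<close>, where \<open>\<delta>\<^sup>2 u = a x \<delta> u + bL p u\<close> and \<open>\<delta>\<^sup>2 v = - a x \<delta> v + bR p v\<close>.
  Because the linear coefficients of the two equations are opposite, sum and difference of \<open>U\<close>
  and \<open>V\<close> nearly decouple: \<open>\<delta> T\<close> has no term in \<open>T\<close>, and \<open>U - V\<close> can be isolated after three
  differentiations, which leaves one more for the final equation.
\<close>

lemma product_ode:
  fixes x p K a bL bR y U V T :: "'a::field_char_0 poly"
  assumes dx: "pderiv x = 1"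
    and const: "pderiv K = 0" "pderiv a = 0" "pderiv bL = 0" "pderiv bR = 0"
    and p: "p = x\<^sup>2 - 1" and p0: "p \<noteq> 0"
    and dy: "K * p * pderiv y = U + V"
    and dU: "K * p * pderiv U = a * x * U + bL * p * y + T"
    and dV: "K * p * pderiv V = - a * x * V + bR * p * y + T"
    and dT: "K * p * pderiv T = p * (bL * V + bR * U)"
    and s: "s = bL + bR" and d: "d = bL - bR"
  shows "K^4 * p^2 * (pderiv ^^ 4) y + 10 * K^4 * x * p * (pderiv ^^ 3) y
    + K^2 * ((24 * K^2 - 2 * s - a^2) * x^2 + (2 * s - 8 * K^2)) * (pderiv ^^ 2) y
    + 3 * K^2 * (4 * K^2 - 2 * s - a^2) * x * pderiv y
    + (d^2 - 2 * K * a * d - 2 * K^2 * s) * y = 0"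
proof -
  define y1 where "y1 = pderiv y"
  define y2 where "y2 = pderiv y1"
  define y3 where "y3 = pderiv y2"
  define y4 where "y4 = pderiv y3"
  note ys = y1_def[symmetric] y2_def[symmetric] y3_def[symmetric] y4_def[symmetric]
  have dp: "pderiv p = 2 * x"
    unfolding p by (simp add: pderiv_diff power2_eq_square pderiv_mult dx)
  have ds: "pderiv s = 0" and dd: "pderiv d = 0"
    by (simp_all add: s d pderiv_add pderiv_diff const)
  note der = pderiv_add pderiv_diff pderiv_mult pderiv_minus dx const dp ds dd ys power2_eq_square
  define S where "S = U + V"
  define D where "D = U - V"
  have S: "S = K * p * y1" using dy by (simp add: S_def y1_def)
  have dS: "K * p * pderiv S = a * x * D + s * p * y + 2 * T"
    using dU dV unfolding S_def D_def s pderiv_add by algebra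
  have dD: "K * p * pderiv D = a * x * S + d * p * y"
    using dU dV unfolding S_def D_def d pderiv_diff by algebra
  have dT2: "2 * K * pderiv T = s * S - d * D"
  proof -
    have "p * (2 * K * pderiv T) = p * (s * S - d * D)"
      using dT unfolding s d S_def D_def by algebra
    with p0 show ?thesis by simp
  qed
  have S': "pderiv S = K * (p * y2 + 2 * x * y1)"
    unfolding S by (simp add: der algebra_simps)
  \<comment> \<open>\<open>E\<close> is expressed through \<open>y\<close> alone; differentiating its second form removes \<open>T\<close>.\<close>
  define E where "E = K^2 * p * (p * y2 + 2 * x * y1) - s * p * y"
  have E: "E = a * x * D + 2 * T"
    using dS unfolding S' E_def by algebra
  have dE: "K * pderiv E = (K * a - d) * D + (a^2 + s) * S + a * d * x * y + a^2 * K * y1"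
  proof -
    have "pderiv E = a * D + a * x * pderiv D + 2 * pderiv T"
      unfolding E by (simp add: der algebra_simps)
    then have "p * (K * pderiv E) =
        p * ((K * a - d) * D + (a^2 + s) * S + a * d * x * y + a^2 * K * y1)"
      using dD dT2 S p by algebra
    with p0 show ?thesis by simp
  qed
  \<comment> \<open>Likewise \<open>H\<close> is expressed through \<open>y\<close>, and differentiating its second form removes \<open>D\<close>.\<close>
  define H where "H = K * pderiv E - (a^2 + s) * K * p * y1 - a * d * x * y - a^2 * K * y1"
  have H: "H = (K * a - d) * D" unfolding H_def dE S by algebra
  have dH: "K * pderiv H = (K * a - d) * (a * x * K * y1 + d * y)"
  proof -
    have "pderiv H = (K * a - d) * pderiv D"
      unfolding H by (simp add: der algebra_simps)
    then have "p * (K * pderiv H) = p * ((K * a - d) * (a * x * K * y1 + d * y))"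
      using dD S by algebra
    with p0 show ?thesis by simp
  qed
  have E1: "pderiv E = K^2 * (p^2 * y3 + 6 * x * p * y2 + (6 * x^2 - 2) * y1) - s * (2 * x * y + p * y1)"
    unfolding E_def by (simp add: der) (simp add: p algebra_simps power2_eq_square)
  have H1: "pderiv H = K^3 * (p^2 * y4 + 10 * x * p * y3 + (24 * x^2 - 8) * y2 + 12 * x * y1)
      - K * s * (p * y2 + 4 * x * y1 + 2 * y)
      - (a^2 + s) * K * (p * y2 + 2 * x * y1) - a * d * (y + x * y1) - a^2 * K * y2"
    unfolding H_def E1
    by (simp add: der) (simp add: p algebra_simps power2_eq_square power3_eq_cube)
  have higher: "(pderiv ^^ 2) y = y2" "(pderiv ^^ 3) y = y3" "(pderiv ^^ 4) y = y4" "pderiv y = y1"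
    by (simp_all add: eval_nat_numeral ys)
  show ?thesis
    unfolding higher p using dH[unfolded H1 p] by algebra
qed

section \<open>The transfer matrices and their differential system\<close>

text \<open>
  The matrix relation \<open>K p M' = A\<^sub>i M - M A\<^sub>0\<close>, with indices counted from \<open>0\<close>, for \<open>M\<close> with rows
  \<open>(f\<^sub>i\<^sub>+\<^sub>1, g\<^sub>i\<^sub>+\<^sub>1)\<close> and \<open>(f\<^sub>i, g\<^sub>i)\<close> and for \<open>A\<^sub>i\<close> with rows \<open>(u\<^sub>i x, - v\<^sub>i)\<close> and \<open>(u\<^sub>i, - v\<^sub>i x)\<close>.  At \<open>i = 0\<close> the matrix \<open>M\<close> is
  the identity and both sides vanish.  In the inductive step the lower row follows from the
  previous upper one by the recursion, and the upper one by differentiating the recursion.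
\<close>

lemma ladder_relations:
  fixes x p K \<alpha> \<beta> :: "'a::field_char_0 poly" and f g u v :: "nat \<Rightarrow> 'a poly"
  assumes dx: "pderiv x = 1"
    and const: "pderiv K = 0" "pderiv \<alpha> = 0" "pderiv \<beta> = 0"
    and p: "p = x\<^sup>2 - 1"
    and u: "\<And>i. u i = \<alpha> + of_nat i * K" and v: "\<And>i. v i = \<beta> + of_nat i * K"
    and nz: "\<And>i. u (Suc i) \<noteq> 0"
    and f: "\<And>i. u (Suc i) * f (Suc (Suc i)) = (u (Suc i) + v i) * x * f (Suc i) - v i * f i"
    and g: "\<And>i. u (Suc i) * g (Suc (Suc i)) = (u (Suc i) + v i) * x * g (Suc i) - v i * g i"
    and init: "f 0 = 0" "f (Suc 0) = 1" "g 0 = 1" "g (Suc 0) = 0"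
  shows "K * p * pderiv (f (Suc i)) = u i * x * f (Suc i) - v i * f i - \<alpha> * (x * f (Suc i) + g (Suc i))
    \<and> K * p * pderiv (g (Suc i)) = u i * x * g (Suc i) - v i * g i + \<beta> * (f (Suc i) + x * g (Suc i))
    \<and> K * p * pderiv (f i) = u i * f (Suc i) - v i * x * f i - \<alpha> * (x * f i + g i)
    \<and> K * p * pderiv (g i) = u i * g (Suc i) - v i * x * g i + \<beta> * (f i + x * g i)"
proof (induction i)
  case 0
  show ?case by (simp add: init u v algebra_simps)
next
  case (Suc i)
  have du: "pderiv (u j) = 0" and dv: "pderiv (v j) = 0" for j
    by (simp_all add: u v pderiv_add pderiv_mult const)
  have uS: "u (Suc i) = u i + K" and vS: "v (Suc i) = v i + K"
    by (simp_all add: u v algebra_simps)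
  have deriv_step: "u (Suc i) * pderiv (h (Suc (Suc i))) = (u (Suc i) + v i) * (h (Suc i) + x * pderiv (h (Suc i))) - v i * pderiv (h i)"
    if "u (Suc i) * h (Suc (Suc i)) = (u (Suc i) + v i) * x * h (Suc i) - v i * h i"
    for h :: "nat \<Rightarrow> 'a poly"
    using arg_cong[OF that, of pderiv]
    by (simp add: pderiv_mult pderiv_add pderiv_diff du dv dx algebra_simps)
  note IH = Suc.IH[THEN conjunct1] Suc.IH[THEN conjunct2, THEN conjunct1]
    Suc.IH[THEN conjunct2, THEN conjunct2, THEN conjunct1]
    Suc.IH[THEN conjunct2, THEN conjunct2, THEN conjunct2]
  have "u (Suc i) * (K * p * pderiv (f (Suc (Suc i)))) = u (Suc i) *
      (u (Suc i) * x * f (Suc (Suc i)) - v (Suc i) * f (Suc i) - \<alpha> * (x * f (Suc (Suc i)) + g (Suc (Suc i))))"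
    using deriv_step[of f, OF f] f[of i] g[of i] IH p uS vS by algebra
  moreover have "u (Suc i) * (K * p * pderiv (g (Suc (Suc i)))) = u (Suc i) *
      (u (Suc i) * x * g (Suc (Suc i)) - v (Suc i) * g (Suc i) + \<beta> * (f (Suc (Suc i)) + x * g (Suc (Suc i))))"
    using deriv_step[of g, OF g] f[of i] g[of i] IH p uS vS by algebra
  moreover have "K * p * pderiv (f (Suc i)) = u (Suc i) * f (Suc (Suc i)) - v (Suc i) * x * f (Suc i) - \<alpha> * (x * f (Suc i) + g (Suc i))"
    using f[of i] IH uS vS by algebra
  moreover have "K * p * pderiv (g (Suc i)) = u (Suc i) * g (Suc (Suc i)) - v (Suc i) * x * g (Suc i) + \<beta> * (f (Suc i) + x * g (Suc i))"
    using g[of i] IH uS vS by algebra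
  ultimately show ?case using nz[of i] by (simp only: mult_cancel_left) simp
qed

text \<open>
  This applies \<open>product_ode\<close> to the upper row of \<open>M\<close>.  The right factor of \<open>f\<close> and the right factor
  of \<open>g\<close> are different components of one row solution, which is why only the constant \<open>bR\<close> of
  \<open>product_ode\<close> differs between the two: it is \<open>\<alpha> (\<beta> - K)\<close> for \<open>f\<close> and \<open>\<beta> (\<alpha> + K)\<close> for \<open>g\<close>.
\<close>

lemma transfer_matrix_odes:
  fixes x p K \<alpha> \<beta> a bL :: "'a::field_char_0 poly" and f g u v :: "nat \<Rightarrow> 'a poly"
  assumes dx: "pderiv x = 1"
    and const: "pderiv K = 0" "pderiv \<alpha> = 0" "pderiv \<beta> = 0"
    and p: "p = x\<^sup>2 - 1" and p0: "p \<noteq> 0"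
    and u: "\<And>i. u i = \<alpha> + of_nat i * K" and v: "\<And>i. v i = \<beta> + of_nat i * K"
    and nz: "\<And>i. u (Suc i) \<noteq> 0"
    and f: "\<And>i. u (Suc i) * f (Suc (Suc i)) = (u (Suc i) + v i) * x * f (Suc i) - v i * f i"
    and g: "\<And>i. u (Suc i) * g (Suc (Suc i)) = (u (Suc i) + v i) * x * g (Suc i) - v i * g i"
    and init: "f 0 = 0" "f (Suc 0) = 1" "g 0 = 1" "g (Suc 0) = 0"
    and a: "a = \<alpha> - \<beta>" and bL: "bL = u i * (v i + K)"
  shows "s = bL + \<alpha> * (\<beta> - K) \<Longrightarrow> d = bL - \<alpha> * (\<beta> - K) \<Longrightarrow>
      K^4 * p^2 * (pderiv ^^ 4) (f (Suc i)) + 10 * K^4 * x * p * (pderiv ^^ 3) (f (Suc i))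
      + K^2 * ((24 * K^2 - 2 * s - a^2) * x^2 + (2 * s - 8 * K^2)) * (pderiv ^^ 2) (f (Suc i))
      + 3 * K^2 * (4 * K^2 - 2 * s - a^2) * x * pderiv (f (Suc i))
      + (d^2 - 2 * K * a * d - 2 * K^2 * s) * f (Suc i) = 0" (is "_ \<Longrightarrow> _ \<Longrightarrow> ?F")
    and "s = bL + \<beta> * (\<alpha> + K) \<Longrightarrow> d = bL - \<beta> * (\<alpha> + K) \<Longrightarrow>
      K^4 * p^2 * (pderiv ^^ 4) (g (Suc i)) + 10 * K^4 * x * p * (pderiv ^^ 3) (g (Suc i))
      + K^2 * ((24 * K^2 - 2 * s - a^2) * x^2 + (2 * s - 8 * K^2)) * (pderiv ^^ 2) (g (Suc i))
      + 3 * K^2 * (4 * K^2 - 2 * s - a^2) * x * pderiv (g (Suc i))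
      + (d^2 - 2 * K * a * d - 2 * K^2 * s) * g (Suc i) = 0" (is "_ \<Longrightarrow> _ \<Longrightarrow> ?G")
proof -
  define F0 F1 G0 G1 A B where "F0 = f i" and "F1 = f (Suc i)" and "G0 = g i" and "G1 = g (Suc i)"
    and "A = u i" and "B = v i"
  note ladder = ladder_relations[OF dx const p u v nz f g init, of i, folded F0_def F1_def G0_def G1_def A_def B_def]
  have F1: "K * p * pderiv F1 = A * x * F1 - B * F0 - \<alpha> * (x * F1 + G1)"
    and G1: "K * p * pderiv G1 = A * x * G1 - B * G0 + \<beta> * (F1 + x * G1)"
    and F0: "K * p * pderiv F0 = A * F1 - B * x * F0 - \<alpha> * (x * F0 + G0)"
    and G0: "K * p * pderiv G0 = A * G1 - B * x * G0 + \<beta> * (F0 + x * G0)"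
    using ladder by blast+
  have dA: "pderiv A = 0" and dB: "pderiv B = 0"
    by (simp_all add: A_def B_def u v pderiv_add pderiv_mult const)
  have da: "pderiv a = 0" by (simp add: a pderiv_diff const)
  have aAB: "a = A - B" by (simp add: a A_def B_def u v)
  have AB: "A = B + (\<alpha> - \<beta>)" by (simp add: A_def B_def u v)
  have bL: "bL = A * (B + K)" by (simp add: bL A_def B_def)
  note der = pderiv_add pderiv_diff pderiv_mult pderiv_minus dx const dA dB da
  have dbL: "pderiv bL = 0" by (simp add: bL der)
  have dbR: "pderiv (\<alpha> * (\<beta> - K)) = 0" "pderiv (\<beta> * (\<alpha> + K)) = 0" by (simp_all add: der)
  \<comment> \<open>\<open>U\<close> is what the left action makes of the entry, \<open>V\<close> what the right action makes of it, and
     \<open>T\<close> is the result of both actions.\<close>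
  show ?F if s: "s = bL + \<alpha> * (\<beta> - K)" and d: "d = bL - \<alpha> * (\<beta> - K)"
  proof -
    define U V T where "U = A * x * F1 - B * F0" and "V = - \<alpha> * (x * F1 + G1)"
      and "T = - \<alpha> * (A * x * (x * F1 + G1) - B * (x * F0 + G0))"
    have "K * p * pderiv F1 = U + V" unfolding F1 U_def V_def by simp
    moreover have "K * p * pderiv U = a * x * U + bL * p * F1 + T"
      unfolding U_def T_def bL aAB der using F1 F0 p by algebra
    moreover have "K * p * pderiv V = - a * x * V + \<alpha> * (\<beta> - K) * p * F1 + T"
      unfolding V_def T_def a der using F1 G1 p by algebra
    moreover have "K * p * pderiv T = p * (bL * V + \<alpha> * (\<beta> - K) * U)"
    proof -
      define X1 X0 where "X1 = x * F1 + G1" and "X0 = x * F0 + G0"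
      have dX1: "K * p * pderiv X1 = K * p * F1 + x * (A * x * F1 - B * F0 - \<alpha> * (x * F1 + G1)) + (A * x * G1 - B * G0 + \<beta> * (F1 + x * G1))"
        unfolding X1_def der using F1 G1 by algebra
      have dX0: "K * p * pderiv X0 = K * p * F0 + x * (A * F1 - B * x * F0 - \<alpha> * (x * F0 + G0)) + (A * G1 - B * x * G0 + \<beta> * (F0 + x * G0))"
        unfolding X0_def der using F0 G0 by algebra
      have "pderiv T = - \<alpha> * (A * X1 + A * x * pderiv X1 - B * pderiv X0)"
        unfolding T_def X1_def[symmetric] X0_def[symmetric]
        by (simp add: pderiv_mult pderiv_diff pderiv_minus dx const dA dB)
      then have dT: "K * p * pderiv T = - \<alpha> * (A * (K * p * X1) + A * x * (K * p * pderiv X1) - B * (K * p * pderiv X0))"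
        by algebra
      show ?thesis
        unfolding dT dX1 dX0
        by (simp add: X1_def X0_def U_def V_def bL AB p algebra_simps power2_eq_square)
    qed
    ultimately show ?F
      using product_ode[OF dx const(1) da dbL dbR(1) p p0 _ _ _ _ s d, of F1 U V T]
      by (simp only: F1_def)
  qed
  show ?G if s: "s = bL + \<beta> * (\<alpha> + K)" and d: "d = bL - \<beta> * (\<alpha> + K)"
  proof -
    define U V T where "U = A * x * G1 - B * G0" and "V = \<beta> * (F1 + x * G1)"
      and "T = \<beta> * (A * x * (F1 + x * G1) - B * (F0 + x * G0))"
    have "K * p * pderiv G1 = U + V" unfolding G1 U_def V_def by simp
    moreover have "K * p * pderiv U = a * x * U + bL * p * G1 + T"
      unfolding U_def T_def bL aAB der using G1 G0 p by algebra
    moreover have "K * p * pderiv V = - a * x * V + \<beta> * (\<alpha> + K) * p * G1 + T"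
      unfolding V_def T_def a der using F1 G1 p by algebra
    moreover have "K * p * pderiv T = p * (bL * V + \<beta> * (\<alpha> + K) * U)"
    proof -
      define X1 X0 where "X1 = F1 + x * G1" and "X0 = F0 + x * G0"
      have dX1: "K * p * pderiv X1 = K * p * G1 + (A * x * F1 - B * F0 - \<alpha> * (x * F1 + G1)) + x * (A * x * G1 - B * G0 + \<beta> * (F1 + x * G1))"
        unfolding X1_def der using F1 G1 by algebra
      have dX0: "K * p * pderiv X0 = K * p * G0 + (A * F1 - B * x * F0 - \<alpha> * (x * F0 + G0)) + x * (A * G1 - B * x * G0 + \<beta> * (F0 + x * G0))"
        unfolding X0_def der using F0 G0 by algebra
      have "pderiv T = \<beta> * (A * X1 + A * x * pderiv X1 - B * pderiv X0)"
        unfolding T_def X1_def[symmetric] X0_def[symmetric]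
        by (simp add: pderiv_mult pderiv_diff pderiv_minus dx const dA dB)
      then have dT: "K * p * pderiv T = \<beta> * (A * (K * p * X1) + A * x * (K * p * pderiv X1) - B * (K * p * pderiv X0))"
        by algebra
      show ?thesis
        unfolding dT dX1 dX0
        by (simp add: X1_def X0_def U_def V_def bL AB p algebra_simps power2_eq_square)
    qed
    ultimately show ?G
      using product_ode[OF dx const(1) da dbL dbR(2) p p0 _ _ _ _ s d, of G1 U V T]
      by (simp only: G1_def)
  qed
qed

section \<open>The two families\<close>

lemma pderiv_of_int: "pderiv (of_int z :: 'a::field_char_0 poly) = 0"
  by (simp add: of_int_poly)

text \<open>
  Both steps of the recursion, \<open>r\<close> and \<open>2r\<close>, preserve the residue of the index modulo \<open>r\<close>.
\<close>

lemma recursion_vanishes_off_multiples: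
  assumes "r \<ge> 2" "m \<ge> 2" and rec: "satisfies_recursion r m P"
    and init: "\<And>j. j \<in> {-2*r..-1} \<Longrightarrow> \<not> r dvd j \<Longrightarrow> P j = 0"
    and "\<not> r dvd k" "k \<ge> -2*r"
  shows "P k = 0"
  using assms(5,6)
proof (induction "nat (k + 2*r)" arbitrary: k rule: less_induct)
  case less
  show ?case
  proof (cases "k < 0")
    case True
    then show ?thesis using less.prems init by simp
  next
    case False
    have nd: "\<not> r dvd k - r" "\<not> r dvd k - 2*r"
      using less.prems(1) dvd_diff_left_iff[of r] by simp_all
    have "2*r + m + k*m > 0" using assms(1,2) False by (simp add: add_pos_nonneg)
    then have nz: "(of_int (2*r + m + k*m) :: complex poly) \<noteq> 0"
      by (metis of_int_eq_0_iff less_irrefl)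
    have "P (k - r) = 0" "P (k - 2*r) = 0"
      using less.hyps[of "k - r"] less.hyps[of "k - 2*r"] nd False assms(1) by auto
    then have "of_int (2*r + m + k*m) * P k = 0"
      using rec False unfolding satisfies_recursion_def by simp
    with nz show ?thesis by simp
  qed
qed

lemma satisfies_ode_zero: "satisfies_ode r m X Y Z W 0"
  by (simp add: satisfies_ode_def eval_nat_numeral)

text \<open>
  The general equation with integer parameters and \<open>K = r m\<close> is \<open>m\<^sup>2\<close> times the equation
  in the form of \<open>satisfies_ode\<close>.
\<close>

lemma satisfies_ode_if_product_ode:
  fixes r m K s d a X Y Z W :: int and y :: "complex poly"
  assumes ode: "of_int K^4 * p^2 * (pderiv ^^ 4) y + 10 * of_int K^4 * cvar * p * (pderiv ^^ 3) y
      + of_int K^2 * ((24 * of_int K^2 - 2 * of_int s - of_int a^2) * cvar^2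
        + (2 * of_int s - 8 * of_int K^2)) * (pderiv ^^ 2) y
      + 3 * of_int K^2 * (4 * of_int K^2 - 2 * of_int s - of_int a^2) * cvar * pderiv y
      + (of_int d^2 - 2 * of_int K * of_int a * of_int d - 2 * of_int K^2 * of_int s) * y = 0"
    and p: "p = cvar^2 - 1"
    and K: "K = r * m" and m: "m \<noteq> 0"
    and X: "X = r^2 * (24 * K^2 - 2 * s - a^2)" and Y: "Y = r^2 * (2 * s - 8 * K^2)"
    and Z: "Z = 3 * r^2 * (4 * K^2 - 2 * s - a^2)"
    and W: "m^2 * W = d^2 - 2 * K * a * d - 2 * K^2 * s"
  shows "satisfies_ode r m X Y Z W y"
proof -
  define x where "x = cvar"
  define y1 where "y1 = pderiv y"
  define y2 where "y2 = (pderiv ^^ 2) y"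
  define y3 where "y3 = (pderiv ^^ 3) y"
  define y4 where "y4 = (pderiv ^^ 4) y"
  note folds = x_def[symmetric] y1_def[symmetric] y2_def[symmetric] y3_def[symmetric] y4_def[symmetric]
  define r' m' K' s' d' a' W' :: "complex poly" where "r' = of_int r" and "m' = of_int m"
    and "K' = of_int K" and "s' = of_int s" and "d' = of_int d" and "a' = of_int a" and "W' = of_int W"
  note ints = r'_def[symmetric] m'_def[symmetric] K'_def[symmetric] s'_def[symmetric]
    d'_def[symmetric] a'_def[symmetric] W'_def[symmetric]
  have K': "K' = r' * m'" by (simp add: r'_def m'_def K'_def K)
  have W': "m'^2 * W' = d'^2 - 2 * K' * a' * d' - 2 * K'^2 * s'"
    using arg_cong[OF W, of "of_int :: int \<Rightarrow> complex poly"] by (simp add: ints)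
  define L where "L = (x^2 - 1)^2 * (m'^2 * r'^4) * y4 + 10 * x * (x^2 - 1) * (m'^2 * r'^4) * y3
     + (r'^2 * (24 * K'^2 - 2 * s' - a'^2) * x^2 + r'^2 * (2 * s' - 8 * K'^2)) * y2
     + 3 * r'^2 * (4 * K'^2 - 2 * s' - a'^2) * x * y1 + W' * y"
  have "m'^2 * L = 0"
    using ode[unfolded p, unfolded folds ints] K' W' unfolding L_def by algebra
  moreover have "m' \<noteq> 0" using m by (simp add: m'_def)
  ultimately have "L = 0" by simp
  then show ?thesis
    unfolding satisfies_ode_def folds X Y Z L_def by (simp add: ints)
qed

lemma family_odes:
  fixes r m :: int
  assumes r: "r \<ge> 2" and m: "m \<ge> 2" and P: "type1_family r m P" and Q: "type2_family r m Q" and "n \<ge> 0"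
  shows "satisfies_ode r m (X1 r m n) (Y1 r m n) (Z1 r m n) (W1 r m n) (P (n - 2*r))"
    and "satisfies_ode r m (X2 r m n) (Y2 r m n) (Z2 r m n) (W2 r m n) (Q (n - 2*r))"
proof -
  have recP: "satisfies_recursion r m P" and recQ: "satisfies_recursion r m Q"
    using P Q by (simp_all add: type1_family_def type2_family_def)
  consider (off) "\<not> r dvd n" | (zero) "n = 0" | (pos) i where "n = r * int (Suc i)"
  proof (cases "r dvd n")
    case True
    then obtain j where j: "n = r * j" by blast
    with \<open>n \<ge> 0\<close> r have "j \<ge> 0" by (simp add: zero_le_mult_iff)
    show ?thesis
    proof (cases "j = 0")
      case False
      with \<open>j \<ge> 0\<close> have "j = int (Suc (nat j - 1))" by simp
      with j pos show ?thesis by metis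
    qed (use j zero in simp)
  qed (use off in simp)
  then have "satisfies_ode r m (X1 r m n) (Y1 r m n) (Z1 r m n) (W1 r m n) (P (n - 2*r)) \<and>
     satisfies_ode r m (X2 r m n) (Y2 r m n) (Z2 r m n) (W2 r m n) (Q (n - 2*r))"
  proof cases
    case off
    then have nd: "\<not> r dvd n - 2*r" by (simp add: dvd_diff_left_iff)
    have "P (n - 2*r) = 0"
    proof (rule recursion_vanishes_off_multiples[OF r m recP _ nd])
      fix j assume "j \<in> {-2*r..-1}" "\<not> r dvd j"
      moreover from this have "j \<noteq> -2*r" by auto
      ultimately show "P j = 0" using P by (auto simp: type1_family_def)
    qed (use \<open>n \<ge> 0\<close> in simp)
    moreover have "Q (n - 2*r) = 0"
    proof (rule recursion_vanishes_off_multiples[OF r m recQ _ nd])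
      fix j assume "j \<in> {-2*r..-1}" "\<not> r dvd j"
      moreover from this have "j \<noteq> -r" by auto
      ultimately show "Q j = 0" using Q by (auto simp: type2_family_def)
    qed (use \<open>n \<ge> 0\<close> in simp)
    ultimately show ?thesis by (simp add: satisfies_ode_zero)
  next
    \<comment> \<open>The upper row of the matrix starts at \<open>n = r\<close>; at \<open>n = 0\<close> the polynomials are constant.\<close>
    case zero
    have "P (n - 2*r) = 1" "Q (n - 2*r) = 0"
      using zero P Q r by (auto simp: type1_family_def type2_family_def)
    moreover have "satisfies_ode r m (X1 r m 0) (Y1 r m 0) (Z1 r m 0) (W1 r m 0) 1"
      by (simp add: satisfies_ode_def W1_def eval_nat_numeral)
    ultimately show ?thesis using zero by (simp add: satisfies_ode_zero)
  next
    case (pos i)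
    \<comment> \<open>The coefficients are those of the recursion multiplied out: \<open>u j\<close> is \<open>2r + m + km\<close> at
       \<open>k = (j - 1) r\<close>, and \<open>v j\<close> is \<open>(k - (2r - 1)) m\<close> at \<open>k = j r\<close>.\<close>
    define K \<alpha> \<beta> where "K = r * m" and "\<alpha> = 2*r + m - K" and "\<beta> = m - 2*K"
    define u v where "u = (\<lambda>i. \<alpha> + int i * K)" and "v = (\<lambda>i. \<beta> + int i * K)"
    define f g where "f = (\<lambda>i. Q (r * int i - 2*r))" and "g = (\<lambda>i. P (r * int i - 2*r))"
    note defs = K_def \<alpha>_def \<beta>_def u_def v_def
    have rec: "of_int (u (Suc i)) * S (r * int (Suc (Suc i)) - 2*r) =
        (of_int (u (Suc i)) + of_int (v i)) * cvar * S (r * int (Suc i) - 2*r)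
        - of_int (v i) * S (r * int i - 2*r)"
      if "satisfies_recursion r m S" for S i
    proof -
      have "r * int i \<ge> 0" using r by simp
      with that have eq: "of_int (2*r + m + r * int i * m) * S (r * int i) =
          2 * cvar * of_int (r + (1 + r * int i - r)*m) * S (r * int i - r)
          - of_int ((r * int i - (2*r - 1)) * m) * S (r * int i - 2*r)"
        unfolding satisfies_recursion_def by blast
      have idx: "r * int (Suc (Suc i)) - 2*r = r * int i" "r * int (Suc i) - 2*r = r * int i - r"
        by (simp_all add: algebra_simps)
      have "u (Suc i) = 2*r + m + r * int i * m" "v i = (r * int i - (2*r - 1)) * m"
        by (simp_all add: defs algebra_simps)
      moreover from this have "u (Suc i) + v i = 2 * (r + (1 + r * int i - r)*m)"
        by (simp add: algebra_simps)
      then have "(of_int (u (Suc i)) + of_int (v i) :: complex poly) = 2 * of_int (r + (1 + r * int i - r)*m)"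
        by (metis of_int_add of_int_mult of_int_numeral)
      ultimately show ?thesis using eq unfolding idx by (simp only: mult_ac)
    qed
    have "u (Suc j) > 0" for j
    proof -
      have "u (Suc j) = 2*r + m + int j * (r * m)" by (simp add: defs algebra_simps)
      then show ?thesis using r m by (simp add: add_pos_nonneg)
    qed
    then have nz: "(of_int (u (Suc j)) :: complex poly) \<noteq> 0" for j
      by (metis of_int_eq_0_iff less_irrefl)
    have dx: "pderiv cvar = 1" by (simp add: pderiv_pCons one_pCons)
    have p0: "cvar^2 - 1 \<noteq> 0" by (simp add: power2_eq_square one_pCons)
    have u': "of_int (u j) = (of_int \<alpha> + of_nat j * of_int K :: complex poly)"
      and v': "of_int (v j) = (of_int \<beta> + of_nat j * of_int K :: complex poly)" for j
      by (simp_all add: u_def v_def)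
    have recf: "of_int (u (Suc j)) * f (Suc (Suc j)) = (of_int (u (Suc j)) + of_int (v j)) * cvar * f (Suc j) - of_int (v j) * f j"
      and recg: "of_int (u (Suc j)) * g (Suc (Suc j)) = (of_int (u (Suc j)) + of_int (v j)) * cvar * g (Suc j) - of_int (v j) * g j" for j
      unfolding f_def g_def by (rule rec[OF recQ] rec[OF recP])+
    have init: "f 0 = 0" "f (Suc 0) = 1" "g 0 = 1" "g (Suc 0) = 0"
      using P Q r by (auto simp: f_def g_def type1_family_def type2_family_def)
    define a bL where "a = \<alpha> - \<beta>" and "bL = u i * (v i + K)"
    note odes = transfer_matrix_odes[where x = cvar and p = "cvar^2 - 1" and K = "of_int K" and \<alpha> = "of_int \<alpha>"
        and \<beta> = "of_int \<beta>" and u = "\<lambda>j. of_int (u j)" and v = "\<lambda>j. of_int (v j)" and f = f and g = g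
        and a = "of_int a" and bL = "of_int bL" and i = i,
        OF dx pderiv_of_int pderiv_of_int pderiv_of_int refl p0 u' v' nz
          recf recg init]
    have idx: "n - 2*r = r * int (Suc i) - 2*r" using pos by simp
    have n: "n = r + r * int i" using pos by (simp add: algebra_simps)
    note coeffs = a_def bL_def defs n power2_eq_square
    have "satisfies_ode r m (X1 r m n) (Y1 r m n) (Z1 r m n) (W1 r m n) (g (Suc i))"
    proof (rule satisfies_ode_if_product_ode[OF odes(2) refl])
      let ?s = "bL + \<beta> * (\<alpha> + K)" and ?d = "bL - \<beta> * (\<alpha> + K)"
      show "of_int ?s = of_int bL + of_int \<beta> * (of_int \<alpha> + of_int K)"
        and "of_int ?d = of_int bL - of_int \<beta> * (of_int \<alpha> + of_int K)" by simp_all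
      show "X1 r m n = r^2 * (24 * K^2 - 2 * ?s - a^2)" unfolding X1_def coeffs by algebra
      show "Y1 r m n = r^2 * (2 * ?s - 8 * K^2)" unfolding Y1_def coeffs by algebra
      show "Z1 r m n = 3 * r^2 * (4 * K^2 - 2 * ?s - a^2)" unfolding Z1_def coeffs by algebra
      show "m^2 * W1 r m n = ?d^2 - 2 * K * a * ?d - 2 * K^2 * ?s" unfolding W1_def coeffs by algebra
    qed (use m in \<open>simp_all add: a_def bL_def K_def\<close>)
    moreover have "satisfies_ode r m (X2 r m n) (Y2 r m n) (Z2 r m n) (W2 r m n) (f (Suc i))"
    proof (rule satisfies_ode_if_product_ode[OF odes(1) refl])
      let ?s = "bL + \<alpha> * (\<beta> - K)" and ?d = "bL - \<alpha> * (\<beta> - K)"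
      show "of_int ?s = of_int bL + of_int \<alpha> * (of_int \<beta> - of_int K)"
        and "of_int ?d = of_int bL - of_int \<alpha> * (of_int \<beta> - of_int K)" by simp_all
      show "X2 r m n = r^2 * (24 * K^2 - 2 * ?s - a^2)" unfolding X2_def Delta2_def coeffs by algebra
      show "Y2 r m n = r^2 * (2 * ?s - 8 * K^2)" unfolding Y2_def coeffs by algebra
      show "Z2 r m n = 3 * r^2 * (4 * K^2 - 2 * ?s - a^2)" unfolding Z2_def Delta2_def coeffs by algebra
      show "m^2 * W2 r m n = ?d^2 - 2 * K * a * ?d - 2 * K^2 * ?s" unfolding W2_def coeffs by algebra
    qed (use m in \<open>simp_all add: a_def bL_def K_def\<close>)
    ultimately show ?thesis unfolding f_def g_def idx by simp
  qed
  then show "satisfies_ode r m (X1 r m n) (Y1 r m n) (Z1 r m n) (W1 r m n) (P (n - 2*r))"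
    and "satisfies_ode r m (X2 r m n) (Y2 r m n) (Z2 r m n) (W2 r m n) (Q (n - 2*r))" by blast+
qed

text \<open>
  The differential system of one family contains the other family as well.  A statement about a
  single family therefore starts by choosing a partner of the other type.
\<close>

theorem theorem2p1:
  fixes r m :: int
  assumes "r \<ge> 2" and "m \<ge> 2"
  shows "(\<forall>P. type1_family r m P \<longrightarrow>
            (\<forall>n\<ge>0. satisfies_ode r m (X1 r m n) (Y1 r m n) (Z1 r m n) (W1 r m n) (P (n - 2*r)))) \<and>
         (\<forall>P. type2_family r m P \<longrightarrow>
            (\<forall>n\<ge>0. satisfies_ode r m (X2 r m n) (Y2 r m n) (Z2 r m n) (W2 r m n) (P (n - 2*r))))"
proof -
  obtain P where "satisfies_recursion r m P" "\<forall>j\<in>{-2*r..-1}. P j = (if j = -2*r then 1 else 0)"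
    using recursion_exists[OF assms, of "\<lambda>j. if j = -2*r then 1 else 0"] by blast
  then have P: "type1_family r m P" using assms by (auto simp: type1_family_def)
  obtain Q where "satisfies_recursion r m Q" "\<forall>j\<in>{-2*r..-1}. Q j = (if j = -r then 1 else 0)"
    using recursion_exists[OF assms, of "\<lambda>j. if j = -r then 1 else 0"] by blast
  then have Q: "type2_family r m Q" using assms by (auto simp: type2_family_def)
  show ?thesis
    using family_odes(1)[OF assms _ Q] family_odes(2)[OF assms P] by blast
qed

end
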